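(* Let $Z=\{Z_t,t\ge 0\}$ be a continuous centered stationary Gaussian process with $f_Z:=\mathbb{E}[Z_0^2]>0$ and covariance $\rho(t)=\rho(-t):=\mathbb{E}[Z_0Z_t]$, $t\ge0$, satisfying $\int_{\mathbb{R}}\rho^2(r)\,dr<\infty$. Let $\widehat f_T(Z):=\frac1T\int_0^TZ_t^2\,dt$, $T>0$. Then the estimator $\widehat f_T(Z)$ is unbiased, i.e. $\mathbb{E}[\widehat f_T(Z)]=f_Z$ for all $T>0$, and strongly consistent, i.e. $\widehat f_T(Z)\to f_Z$ almost surely as $T\to\infty$. In particular, $$\sqrt T\,\|\widehat f_T(Z)-f_Z\|_{L^2}\uparrow\sigma_Z\quad\text{as }T\to\infty.$$
   Context: $\sigma_Z>0$ is given by $\sigma_Z^2:=4\int_0^\infty\rho^2(r)\,dr$. The symbol $\uparrow$ denotes nondecreasing convergence. *)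

theory Defs
  imports "HOL-Probability.Probability"
begin

(* The degenerate case of a Dirac law (variance zero) is allowed: otherwise trivial linear
   combinations would violate the definition of a Gaussian process. *)
definition gaussian_rv :: "'a measure \<Rightarrow> ('a \<Rightarrow> real) \<Rightarrow> bool" where
  "gaussian_rv M X \<longleftrightarrow>
     X \<in> borel_measurable M \<and>
     ((\<exists>\<mu>. AE \<omega> in M. X \<omega> = \<mu>) \<or>
      (\<exists>\<mu> \<sigma>. 0 < \<sigma> \<and> distributed M lborel X (\<lambda>x. ennreal (normal_density \<mu> \<sigma> x))))"

(* A process is a map Z :: real \<Rightarrow> 'a \<Rightarrow> real of which only the times t \<ge> 0 matter. *)
definition gaussian_process :: "'a measure \<Rightarrow> (real \<Rightarrow> 'a \<Rightarrow> real) \<Rightarrow> bool" where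
  "gaussian_process M Z \<longleftrightarrow>
     (\<forall>J a. finite J \<longrightarrow> J \<subseteq> {0..} \<longrightarrow> gaussian_rv M (\<lambda>\<omega>. \<Sum>t\<in>J. a t * Z t \<omega>))"

definition centered_process :: "'a measure \<Rightarrow> (real \<Rightarrow> 'a \<Rightarrow> real) \<Rightarrow> bool" where
  "centered_process M Z \<longleftrightarrow>
     (\<forall>t\<ge>0. integrable M (Z t) \<and> integral\<^sup>L M (Z t) = 0)"

(* Strict stationarity: the finite-dimensional laws are invariant under time shifts. *)
definition stationary_process :: "'a measure \<Rightarrow> (real \<Rightarrow> 'a \<Rightarrow> real) \<Rightarrow> bool" where
  "stationary_process M Z \<longleftrightarrow>
     (\<forall>J h. finite J \<longrightarrow> J \<subseteq> {0..} \<longrightarrow> 0 \<le> h \<longrightarrow>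
        distr M (\<Pi>\<^sub>M t\<in>J. borel) (\<lambda>\<omega>. \<lambda>t\<in>J. Z (t + h) \<omega>) =
        distr M (\<Pi>\<^sub>M t\<in>J. borel) (\<lambda>\<omega>. \<lambda>t\<in>J. Z t \<omega>))"

(* Every sample path is continuous, not merely almost every one, so that the time averages
   below are random variables also when M is not complete. *)
definition continuous_process :: "'a measure \<Rightarrow> (real \<Rightarrow> 'a \<Rightarrow> real) \<Rightarrow> bool" where
  "continuous_process M Z \<longleftrightarrow> (\<forall>\<omega>\<in>space M. continuous_on {0..} (\<lambda>t. Z t \<omega>))"

definition f_Z :: "'a measure \<Rightarrow> (real \<Rightarrow> 'a \<Rightarrow> real) \<Rightarrow> real" where
  "f_Z M Z = (\<integral>\<omega>. (Z 0 \<omega>)\<^sup>2 \<partial>M)"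

(* The absolute value implements the even extension \<rho>(-t) = \<rho>(t). *)
definition rho :: "'a measure \<Rightarrow> (real \<Rightarrow> 'a \<Rightarrow> real) \<Rightarrow> real \<Rightarrow> real" where
  "rho M Z t = (\<integral>\<omega>. Z 0 \<omega> * Z \<bar>t\<bar> \<omega> \<partial>M)"

definition sigma_Z :: "'a measure \<Rightarrow> (real \<Rightarrow> 'a \<Rightarrow> real) \<Rightarrow> real" where
  "sigma_Z M Z = sqrt (4 * (LBINT r:{0..}. (rho M Z r)\<^sup>2))"

definition f_hat :: "(real \<Rightarrow> 'a \<Rightarrow> real) \<Rightarrow> real \<Rightarrow> 'a \<Rightarrow> real" where
  "f_hat Z T \<omega> = 1 / T * (LBINT t:{0..T}. (Z t \<omega>)\<^sup>2)"

(* Meaningful only for square integrable X. *)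
definition L2_norm :: "'a measure \<Rightarrow> ('a \<Rightarrow> real) \<Rightarrow> real" where
  "L2_norm M X = sqrt (\<integral>\<omega>. (X \<omega>)\<^sup>2 \<partial>M)"

end

theory Submission
  imports Defs
begin

text \<open>
  Everything about the estimator follows from one formula for its mean square error. For a centered
  Gaussian process the covariance of \<open>Z s ^ 2\<close> and \<open>Z t ^ 2\<close> is \<open>2 \<rho>(t - s)^2\<close> (Isserlis' formula,
  \<open>isserlis_squares\<close>, obtained from the fourth moment of a single normal variable by polarization).
  Writing \<open>T (f_hat - f_Z)\<close> as the integral of \<open>Z t ^ 2 - f_Z\<close> over the window \<open>[0, T]\<close>, its second
  moment is the double integral of these covariances (\<open>second_moment_of_integral\<close>), and integrating
  along the diagonals (\<open>double_integral_of_difference\<close>) gives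

    \<open>T * E (f_hat - f_Z)^2 = 2 * \<integral> \<rho>(r)^2 * max 0 (1 - \<bar>r\<bar> / T) dr\<close>.

  The weight on the right increases to \<open>1\<close> as \<open>T\<close> grows. Hence the scaled \<open>L2\<close> error is
  nondecreasing, and by dominated convergence its square tends to \<open>2 \<integral> \<rho>^2\<close> over the whole line,
  which is \<open>sigma_Z^2\<close> because \<open>\<rho>\<close> is even.

  Strong consistency comes from the same formula, without an ergodic theorem: it bounds the variance of \<open>f_hat\<close> by a
  constant over \<open>T\<close>; along \<open>T = n^2\<close> these bounds are summable, so \<open>f_hat\<close> converges almost surely
  along the squares (\<open>AE_tendsto_0_of_summable_second_moments\<close>). Since \<open>T * f_hat\<close> is nondecreasing
  in \<open>T\<close>, the values between two squares are squeezed (\<open>tendsto_average_of_squares\<close>).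

  Unbiasedness is Fubini's theorem together with \<open>E (Z t)^2 = f_Z\<close>. Its measure-theoretic input is
  joint measurability of the process, supplied by path continuity
  (\<open>measurable_of_continuous_paths\<close>).
\<close>

section \<open>Moments of Gaussian pairs\<close>

text \<open>
  Centering enters in both branches of the definition of a Gaussian variable: it forces the constant
  of a degenerate law to be zero, and it makes the raw moments of a normal law equal to the central
  ones, which are known in closed form.
\<close>
lemma fourth_moment_of_centered_gaussian:
  assumes "prob_space M" and "gaussian_rv M X" and "integral\<^sup>L M X = 0"
  shows "integrable M (\<lambda>\<omega>. (X \<omega>) ^ 4)"
    and "(\<integral>\<omega>. (X \<omega>) ^ 4 \<partial>M) = 3 * (\<integral>\<omega>. (X \<omega>)\<^sup>2 \<partial>M)\<^sup>2"
proof -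
  interpret prob_space M by fact
  have X[measurable]: "X \<in> borel_measurable M" using assms(2) by (simp add: gaussian_rv_def)
  consider (const) c where "AE \<omega> in M. X \<omega> = c"
    | (normal) \<mu> \<sigma> where "0 < \<sigma>" "distributed M lborel X (\<lambda>x. ennreal (normal_density \<mu> \<sigma> x))"
    using assms(2) by (auto simp: gaussian_rv_def)
  then have "integrable M (\<lambda>\<omega>. (X \<omega>) ^ 4) \<and>
    (\<integral>\<omega>. (X \<omega>) ^ 4 \<partial>M) = 3 * (\<integral>\<omega>. (X \<omega>)\<^sup>2 \<partial>M)\<^sup>2"
  proof cases
    case const
    have "integral\<^sup>L M X = (\<integral>\<omega>. c \<partial>M)"
      using const by (intro integral_cong_AE) auto
    then have "c = 0" using assms(3) by (simp add: prob_space)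
    have "AE \<omega> in M. X \<omega> ^ 4 = 0" "AE \<omega> in M. (X \<omega>)\<^sup>2 = 0"
      using const \<open>c = 0\<close> by auto
    then show ?thesis
      using integral_cong_AE[of "\<lambda>\<omega>. X \<omega> ^ 4" M "\<lambda>_. 0"]
        integral_cong_AE[of "\<lambda>\<omega>. (X \<omega>)\<^sup>2" M "\<lambda>_. 0"]
        integrable_cong_AE[of "\<lambda>\<omega>. X \<omega> ^ 4" M "\<lambda>_. 0"]
      by simp
  next
    case normal
    have "\<mu> = 0"
      using normal_distributed_expectation[OF normal] assms(3) by simp
    have int: "integrable M (\<lambda>\<omega>. X \<omega> ^ (2 * k)) \<and>
        (\<integral>\<omega>. X \<omega> ^ (2 * k) \<partial>M) = fact (2 * k) / ((2 / \<sigma>\<^sup>2) ^ k * fact k)" for k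
      using has_bochner_integral_iff[THEN iffD1, OF normal_moment_even[OF \<open>0 < \<sigma>\<close>, of \<mu> k]] \<open>\<mu> = 0\<close>
        distributed_integrable[OF normal(2), of "\<lambda>x. x ^ (2 * k)"]
        distributed_integral[OF normal(2), of "\<lambda>x. x ^ (2 * k)"]
      by auto
    show ?thesis
      using int[of 1] int[of 2] \<open>0 < \<sigma>\<close>
      by (simp add: fact_numeral field_simps power2_eq_square)
  qed
  then show "integrable M (\<lambda>\<omega>. (X \<omega>) ^ 4)"
    and "(\<integral>\<omega>. (X \<omega>) ^ 4 \<partial>M) = 3 * (\<integral>\<omega>. (X \<omega>)\<^sup>2 \<partial>M)\<^sup>2" by auto
qed

lemma square_integrable_of_fourth_power:
  fixes X :: "'a \<Rightarrow> real"
  assumes "prob_space M" "X \<in> borel_measurable M" "integrable M (\<lambda>\<omega>. X \<omega> ^ 4)"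
  shows "integrable M (\<lambda>\<omega>. (X \<omega>)\<^sup>2)"
proof -
  interpret prob_space M by fact
  have "((X \<omega>)\<^sup>2)\<^sup>2 = X \<omega> ^ 4" for \<omega> by algebra
  then have "integrable M (\<lambda>\<omega>. ((X \<omega>)\<^sup>2)\<^sup>2)" using assms(3) by presburger
  with square_integrable_imp_integrable[of "\<lambda>\<omega>. (X \<omega>)\<^sup>2"] show ?thesis
    using assms(2) by simp
qed

lemma integrable_product_of_squares:
  fixes X Y :: "'a \<Rightarrow> real"
  assumes [measurable]: "X \<in> borel_measurable M" "Y \<in> borel_measurable M"
    and "integrable M (\<lambda>\<omega>. (X \<omega>)\<^sup>2)" "integrable M (\<lambda>\<omega>. (Y \<omega>)\<^sup>2)"
  shows "integrable M (\<lambda>\<omega>. X \<omega> * Y \<omega>)"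
proof (rule Bochner_Integration.integrable_bound)
  show "integrable M (\<lambda>\<omega>. (X \<omega>)\<^sup>2 + (Y \<omega>)\<^sup>2)" using assms by simp
  have "\<bar>x * y\<bar> \<le> x\<^sup>2 + y\<^sup>2" for x y :: real
    using sum_squares_bound[of "\<bar>x\<bar>" "\<bar>y\<bar>"] abs_ge_zero[of "x * y"]
    unfolding abs_mult power2_abs by linarith
  then show "AE \<omega> in M. norm (X \<omega> * Y \<omega>) \<le> norm ((X \<omega>)\<^sup>2 + (Y \<omega>)\<^sup>2)" by simp
qed simp

text \<open>
  Polarization: every linear combination of \<open>X\<close> and \<open>Y\<close> is Gaussian, so the fourth moments of
  \<open>X\<close>, \<open>Y\<close>, \<open>X + Y\<close> and \<open>X - Y\<close> are determined by their variances, and the identity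
  \<open>(x + y)^4 + (x - y)^4 = 2 x^4 + 12 x^2 y^2 + 2 y^4\<close> isolates the mixed moment. Unlike
  a computation with the joint density, this also covers dependent pairs without density, such as
  \<open>X = Y\<close>.
\<close>
lemma isserlis_squares:
  assumes P: "prob_space M"
    and lin: "\<And>a b :: real. gaussian_rv M (\<lambda>\<omega>. a * X \<omega> + b * Y \<omega>)"
    and cen: "integrable M X" "integrable M Y" "integral\<^sup>L M X = 0" "integral\<^sup>L M Y = 0"
  shows "integrable M (\<lambda>\<omega>. X \<omega> * Y \<omega>)"
    and "integrable M (\<lambda>\<omega>. (X \<omega>)\<^sup>2 * (Y \<omega>)\<^sup>2)"
    and "(\<integral>\<omega>. (X \<omega>)\<^sup>2 * (Y \<omega>)\<^sup>2 \<partial>M) =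
      (\<integral>\<omega>. (X \<omega>)\<^sup>2 \<partial>M) * (\<integral>\<omega>. (Y \<omega>)\<^sup>2 \<partial>M) + 2 * (\<integral>\<omega>. X \<omega> * Y \<omega> \<partial>M)\<^sup>2"
proof -
  have mX[measurable]: "X \<in> borel_measurable M" and mY[measurable]: "Y \<in> borel_measurable M"
    using cen by auto
  note four = fourth_moment_of_centered_gaussian[OF P lin]
  have iX4: "integrable M (\<lambda>\<omega>. X \<omega> ^ 4)" and iY4: "integrable M (\<lambda>\<omega>. Y \<omega> ^ 4)"
    and eX4: "(\<integral>\<omega>. X \<omega> ^ 4 \<partial>M) = 3 * (\<integral>\<omega>. (X \<omega>)\<^sup>2 \<partial>M)\<^sup>2"
    and eY4: "(\<integral>\<omega>. Y \<omega> ^ 4 \<partial>M) = 3 * (\<integral>\<omega>. (Y \<omega>)\<^sup>2 \<partial>M)\<^sup>2"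
    using four[of 1 0] four[of 0 1] cen by simp_all
  have ip4: "integrable M (\<lambda>\<omega>. (X \<omega> + Y \<omega>) ^ 4)" and im4: "integrable M (\<lambda>\<omega>. (X \<omega> - Y \<omega>) ^ 4)"
    and ep4: "(\<integral>\<omega>. (X \<omega> + Y \<omega>) ^ 4 \<partial>M) = 3 * (\<integral>\<omega>. (X \<omega> + Y \<omega>)\<^sup>2 \<partial>M)\<^sup>2"
    and em4: "(\<integral>\<omega>. (X \<omega> - Y \<omega>) ^ 4 \<partial>M) = 3 * (\<integral>\<omega>. (X \<omega> - Y \<omega>)\<^sup>2 \<partial>M)\<^sup>2"
    using four[of 1 1] four[of 1 "-1"] cen by simp_all
  have iX2: "integrable M (\<lambda>\<omega>. (X \<omega>)\<^sup>2)" and iY2: "integrable M (\<lambda>\<omega>. (Y \<omega>)\<^sup>2)"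
    using square_integrable_of_fourth_power[OF P] iX4 iY4 by simp_all
  show iXY: "integrable M (\<lambda>\<omega>. X \<omega> * Y \<omega>)"
    by (intro integrable_product_of_squares iX2 iY2 mX mY)
  have sq: "(x\<^sup>2)\<^sup>2 = x ^ 4" for x :: real by algebra
  show iX2Y2: "integrable M (\<lambda>\<omega>. (X \<omega>)\<^sup>2 * (Y \<omega>)\<^sup>2)"
    by (rule integrable_product_of_squares) (use iX4 iY4 in \<open>simp_all only: sq, simp_all\<close>)
  let ?x = "\<integral>\<omega>. (X \<omega>)\<^sup>2 \<partial>M" and ?y = "\<integral>\<omega>. (Y \<omega>)\<^sup>2 \<partial>M" and ?c = "\<integral>\<omega>. X \<omega> * Y \<omega> \<partial>M"
  have p2: "(\<integral>\<omega>. (X \<omega> + Y \<omega>)\<^sup>2 \<partial>M) = ?x + 2 * ?c + ?y"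
    using iX2 iY2 iXY by (simp add: power2_sum mult.assoc)
  have m2: "(\<integral>\<omega>. (X \<omega> - Y \<omega>)\<^sup>2 \<partial>M) = ?x - 2 * ?c + ?y"
    using iX2 iY2 iXY by (simp add: power2_diff mult.assoc)
  have "(\<integral>\<omega>. (X \<omega> + Y \<omega>) ^ 4 \<partial>M) + (\<integral>\<omega>. (X \<omega> - Y \<omega>) ^ 4 \<partial>M)
      = (\<integral>\<omega>. (X \<omega> + Y \<omega>) ^ 4 + (X \<omega> - Y \<omega>) ^ 4 \<partial>M)"
    using ip4 im4 by simp
  also have "\<dots> = (\<integral>\<omega>. 2 * X \<omega> ^ 4 + 12 * ((X \<omega>)\<^sup>2 * (Y \<omega>)\<^sup>2) + 2 * Y \<omega> ^ 4 \<partial>M)"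
    by (intro Bochner_Integration.integral_cong refl) algebra
  also have "\<dots> = 2 * (3 * ?x\<^sup>2) + 12 * (\<integral>\<omega>. (X \<omega>)\<^sup>2 * (Y \<omega>)\<^sup>2 \<partial>M) + 2 * (3 * ?y\<^sup>2)"
    using iX4 iY4 iX2Y2 by (simp add: eX4 eY4)
  finally show "(\<integral>\<omega>. (X \<omega>)\<^sup>2 * (Y \<omega>)\<^sup>2 \<partial>M) = ?x * ?y + 2 * ?c\<^sup>2"
    unfolding ep4 em4 p2 m2 by (simp add: power2_eq_square algebra_simps)
qed

section \<open>Time integrals of measurable processes\<close>

text \<open>
  Evaluating the path at the point of the grid of mesh \<open>1 / (n + 1)\<close> just before the current time
  uses only countably many of the variables \<open>Z t\<close>, hence is jointly measurable; continuity of the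
  paths makes these step processes converge to \<open>Z\<close>. Clamping negative times to zero
  makes the extended process measurable on the whole line, since \<open>Z\<close> is only controlled at times
  \<open>t \<ge> 0\<close>.
\<close>
lemma measurable_of_continuous_paths:
  fixes Z :: "real \<Rightarrow> 'a \<Rightarrow> real"
  assumes Z: "\<And>t. 0 \<le> t \<Longrightarrow> Z t \<in> borel_measurable M"
    and cont: "\<And>\<omega>. \<omega> \<in> space M \<Longrightarrow> continuous_on {0..} (\<lambda>t. Z t \<omega>)"
  shows "(\<lambda>(t, \<omega>). Z (max 0 t) \<omega>) \<in> borel_measurable (borel \<Otimes>\<^sub>M M)"
proof -
  define grid where "grid n t = nat \<lfloor>real (Suc n) * t\<rfloor>" for n t
  \<comment> \<open>For negative times the conversion to natural numbers makes the grid index 0.\<close>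
  have grid_tendsto: "(\<lambda>n. real (grid n t) / real (Suc n)) \<longlonglongrightarrow> max 0 t" for t
  proof (rule tendsto_sandwich)
    show "(\<lambda>n. max 0 t - 1 / real (Suc n)) \<longlonglongrightarrow> max 0 t"
      using tendsto_diff[OF tendsto_const LIMSEQ_Suc[OF lim_1_over_n], of "max 0 t"] by simp
    have "real (Suc n) * max 0 t - 1 \<le> real (grid n t)" for n
    proof (cases "t \<ge> 0")
      case True
      then have "0 \<le> \<lfloor>real (Suc n) * t\<rfloor>" by simp
      then show ?thesis using True unfolding grid_def by linarith
    next
      case False
      then show ?thesis by (simp add: max_def)
    qed
    then have "(real (Suc n) * max 0 t - 1) / real (Suc n) \<le> real (grid n t) / real (Suc n)" for n
      by (intro divide_right_mono) simp_all
    then show "\<forall>\<^sub>F n in sequentially. max 0 t - 1 / real (Suc n) \<le> real (grid n t) / real (Suc n)"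
      by (intro always_eventually allI) (simp add: diff_divide_distrib del: of_nat_Suc)
    have "real (grid n t) \<le> real (Suc n) * max 0 t" for n
    proof (cases "t \<ge> 0")
      case True
      then have "0 \<le> \<lfloor>real (Suc n) * t\<rfloor>" by simp
      then show ?thesis using True unfolding grid_def by linarith
    next
      case False
      then have "real (Suc n) * t \<le> 0" by (simp add: mult_nonneg_nonpos del: of_nat_Suc)
      then have "\<lfloor>real (Suc n) * t\<rfloor> \<le> 0" by linarith
      then show ?thesis unfolding grid_def by simp
    qed
    then show "\<forall>\<^sub>F n in sequentially. real (grid n t) / real (Suc n) \<le> max 0 t"
      by (intro always_eventually allI) (simp add: field_simps del: of_nat_Suc)
  qed simp
  show ?thesis
  proof (rule borel_measurable_LIMSEQ_real)
    fix p assume p: "p \<in> space (borel \<Otimes>\<^sub>M M :: (real \<times> 'a) measure)"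
    obtain t \<omega> where [simp]: "p = (t, \<omega>)" by (cases p)
    have "(\<lambda>n. Z (real (grid n t) / real (Suc n)) \<omega>) \<longlonglongrightarrow> Z (max 0 t) \<omega>"
      using continuous_on_tendsto_compose[OF cont[of \<omega>] grid_tendsto[of t]] p
      by (simp add: space_pair_measure)
    then show "(\<lambda>n. (\<lambda>(t, \<omega>). Z (real (grid n t) / real (Suc n)) \<omega>) p)
        \<longlonglongrightarrow> (case p of (t, \<omega>) \<Rightarrow> Z (max 0 t) \<omega>)"
      by simp
  next
    fix n
    have "(\<lambda>p. real (Suc n) * fst p) \<in> borel_measurable (borel \<Otimes>\<^sub>M M)"
      by (intro borel_measurable_times borel_measurable_const measurable_fst)
    then have "(\<lambda>p. \<lfloor>real (Suc n) * fst p\<rfloor>) \<in> (borel \<Otimes>\<^sub>M M) \<rightarrow>\<^sub>M count_space UNIV"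
      by (rule measurable_compose[OF _ measurable_real_floor])
    then have grid: "(\<lambda>p. grid n (fst p)) \<in> (borel \<Otimes>\<^sub>M M) \<rightarrow>\<^sub>M count_space UNIV"
      unfolding grid_def by (rule measurable_compose) simp
    have "(\<lambda>p. Z (real k / real (Suc n)) (snd p)) \<in> borel_measurable (borel \<Otimes>\<^sub>M M)" for k
      by (rule measurable_compose[OF measurable_snd Z]) simp
    from measurable_compose_countable[where f = "\<lambda>k p. Z (real k / real (Suc n)) (snd p)", OF this grid]
    show "(\<lambda>(t, \<omega>). Z (real (grid n t) / real (Suc n)) \<omega>) \<in> borel_measurable (borel \<Otimes>\<^sub>M M)"
      unfolding case_prod_unfold .
  qed
qed

text \<open>
  Fubini in the form suited to a process on a finite time window: a uniform bound on the absolute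
  moments is all that integrability on the product space requires.
\<close>
lemma expectation_of_integral:
  fixes W :: "'s \<Rightarrow> 'a \<Rightarrow> real"
  assumes "finite_measure N" and "sigma_finite_measure M"
    and W[measurable]: "case_prod W \<in> borel_measurable (N \<Otimes>\<^sub>M M)"
    and int: "\<And>s. s \<in> space N \<Longrightarrow> integrable M (W s)"
    and bound: "\<And>s. s \<in> space N \<Longrightarrow> (\<integral>\<omega>. \<bar>W s \<omega>\<bar> \<partial>M) \<le> K"
  shows "integrable M (\<lambda>\<omega>. \<integral>s. W s \<omega> \<partial>N)"
    and "(\<integral>\<omega>. (\<integral>s. W s \<omega> \<partial>N) \<partial>M) = (\<integral>s. (\<integral>\<omega>. W s \<omega> \<partial>M) \<partial>N)"
proof -
  interpret N: finite_measure N by fact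
  interpret M: sigma_finite_measure M by fact
  interpret NM: pair_sigma_finite N M ..
  have "integrable N (\<lambda>s. \<integral>\<omega>. norm (case_prod W (s, \<omega>)) \<partial>M)"
  proof (rule N.integrable_const_bound)
    show "AE s in N. norm (\<integral>\<omega>. norm (case_prod W (s, \<omega>)) \<partial>M) \<le> K"
      using bound by (intro AE_I2) simp
    show "(\<lambda>s. \<integral>\<omega>. norm (case_prod W (s, \<omega>)) \<partial>M) \<in> borel_measurable N"
      by measurable
  qed
  then have W_int: "integrable (N \<Otimes>\<^sub>M M) (case_prod W)"
    using int by (intro NM.Fubini_integrable W AE_I2) simp_all
  show "integrable M (\<lambda>\<omega>. \<integral>s. W s \<omega> \<partial>N)"
    using NM.integrable_snd[OF W_int] .
  show "(\<integral>\<omega>. (\<integral>s. W s \<omega> \<partial>N) \<partial>M) = (\<integral>s. (\<integral>\<omega>. W s \<omega> \<partial>M) \<partial>N)"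
    using NM.Fubini_integral[OF W_int] .
qed

lemma integral_square_as_double_integral:
  fixes y :: "'s \<Rightarrow> real"
  assumes "sigma_finite_measure N" and y: "integrable N y"
  shows "(\<integral>p. y (fst p) * y (snd p) \<partial>(N \<Otimes>\<^sub>M N)) = (\<integral>s. y s \<partial>N)\<^sup>2"
proof -
  interpret N: sigma_finite_measure N by fact
  interpret NN: pair_sigma_finite N N ..
  have [measurable]: "y \<in> borel_measurable N" using y by auto
  have "integrable (N \<Otimes>\<^sub>M N) (\<lambda>p. y (fst p) * y (snd p))"
    using y by (intro NN.Fubini_integrable) (simp_all add: abs_mult)
  from NN.integral_fst'[OF this] show ?thesis
    by (simp add: power2_eq_square)
qed

text \<open>
  The square of an integral is a double integral, so its expectation is a double integral of
  covariances. A uniform bound on the second moments dominates all mixed moments, since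
  \<open>\<bar>x y\<bar> \<le> (x^2 + y^2) / 2\<close>; this makes Fubini applicable to the product process
  indexed by pairs of times.
\<close>
lemma second_moment_of_integral:
  fixes Y :: "'s \<Rightarrow> 'a \<Rightarrow> real"
  assumes N: "finite_measure N" and M: "sigma_finite_measure M"
    and Y[measurable]: "case_prod Y \<in> borel_measurable (N \<Otimes>\<^sub>M M)"
    and sq: "\<And>s. s \<in> space N \<Longrightarrow> integrable M (\<lambda>\<omega>. (Y s \<omega>)\<^sup>2)"
    and bound: "\<And>s. s \<in> space N \<Longrightarrow> (\<integral>\<omega>. (Y s \<omega>)\<^sup>2 \<partial>M) \<le> K"
    and path: "\<And>\<omega>. \<omega> \<in> space M \<Longrightarrow> integrable N (\<lambda>s. Y s \<omega>)"
  shows "integrable M (\<lambda>\<omega>. (\<integral>s. Y s \<omega> \<partial>N)\<^sup>2)"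
    and "(\<integral>\<omega>. (\<integral>s. Y s \<omega> \<partial>N)\<^sup>2 \<partial>M) =
      (\<integral>p. (\<integral>\<omega>. Y (fst p) \<omega> * Y (snd p) \<omega> \<partial>M) \<partial>(N \<Otimes>\<^sub>M N))"
proof -
  interpret N: finite_measure N by fact
  define W where "W p \<omega> = Y (fst p) \<omega> * Y (snd p) \<omega>" for p \<omega>
  have Y_sec: "Y s \<in> borel_measurable M" if "s \<in> space N" for s
    using measurable_compose[OF measurable_Pair1'[OF that] Y] by simp
  have fin: "finite_measure (N \<Otimes>\<^sub>M N)" using N N by (rule finite_measure_pair_measure)
  have "(\<lambda>q. Y (fst (fst q)) (snd q) * Y (snd (fst q)) (snd q))
      \<in> borel_measurable ((N \<Otimes>\<^sub>M N) \<Otimes>\<^sub>M M)"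
    by measurable
  then have W: "case_prod W \<in> borel_measurable ((N \<Otimes>\<^sub>M N) \<Otimes>\<^sub>M M)"
    by (simp add: W_def case_prod_unfold)
  have W_int: "integrable M (W p)" and W_bound: "(\<integral>\<omega>. \<bar>W p \<omega>\<bar> \<partial>M) \<le> K"
    if p: "p \<in> space (N \<Otimes>\<^sub>M N)" for p
  proof -
    have s: "fst p \<in> space N" "snd p \<in> space N" using p by (auto simp: space_pair_measure)
    show i: "integrable M (W p)"
      unfolding W_def using s by (intro integrable_product_of_squares Y_sec sq)
    have "(\<integral>\<omega>. \<bar>W p \<omega>\<bar> \<partial>M) \<le> (\<integral>\<omega>. ((Y (fst p) \<omega>)\<^sup>2 + (Y (snd p) \<omega>)\<^sup>2) / 2 \<partial>M)"
    proof (rule integral_mono)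
      show "integrable M (\<lambda>\<omega>. \<bar>W p \<omega>\<bar>)" using i by simp
      show "integrable M (\<lambda>\<omega>. ((Y (fst p) \<omega>)\<^sup>2 + (Y (snd p) \<omega>)\<^sup>2) / 2)"
        using sq s by simp
      show "\<bar>W p \<omega>\<bar> \<le> ((Y (fst p) \<omega>)\<^sup>2 + (Y (snd p) \<omega>)\<^sup>2) / 2" for \<omega>
      proof -
        have half: "c \<le> d / 2" if "2 * c \<le> d" for c d :: real using that by simp
        show ?thesis
          using sum_squares_bound[of "\<bar>Y (fst p) \<omega>\<bar>" "\<bar>Y (snd p) \<omega>\<bar>"]
          unfolding W_def abs_mult power2_abs mult.assoc by (rule half)
      qed
    qed
    also have "\<dots> \<le> K"
      using bound[OF s(1)] bound[OF s(2)] sq s by simp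
    finally show "(\<integral>\<omega>. \<bar>W p \<omega>\<bar> \<partial>M) \<le> K" .
  qed
  have square: "(\<integral>p. W p \<omega> \<partial>(N \<Otimes>\<^sub>M N)) = (\<integral>s. Y s \<omega> \<partial>N)\<^sup>2" if "\<omega> \<in> space M" for \<omega>
    unfolding W_def
    by (rule integral_square_as_double_integral[OF N.sigma_finite_measure_axioms path[OF that]])
  note fub = expectation_of_integral[OF fin M W W_int W_bound]
  show "integrable M (\<lambda>\<omega>. (\<integral>s. Y s \<omega> \<partial>N)\<^sup>2)"
    using fub(1) by (subst Bochner_Integration.integrable_cong[OF refl square[symmetric]])
  have "(\<integral>\<omega>. (\<integral>s. Y s \<omega> \<partial>N)\<^sup>2 \<partial>M) = (\<integral>\<omega>. (\<integral>p. W p \<omega> \<partial>(N \<Otimes>\<^sub>M N)) \<partial>M)"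
    by (intro Bochner_Integration.integral_cong refl square[symmetric])
  also have "\<dots> = (\<integral>p. (\<integral>\<omega>. W p \<omega> \<partial>M) \<partial>(N \<Otimes>\<^sub>M N))"
    by (rule fub(2))
  finally show "(\<integral>\<omega>. (\<integral>s. Y s \<omega> \<partial>N)\<^sup>2 \<partial>M) =
      (\<integral>p. (\<integral>\<omega>. Y (fst p) \<omega> * Y (snd p) \<omega> \<partial>M) \<partial>(N \<Otimes>\<^sub>M N))"
    unfolding W_def .
qed

text \<open>
  Lebesgue measure on the observation window, as a finite measure in its own right, so that the
  Fubini lemmas apply without indicator functions.
\<close>
definition window :: "real \<Rightarrow> real measure" where
  "window T = restrict_space lborel {0..T}"

lemma space_window: "space (window T) = {0..T}"
  by (simp add: window_def space_restrict_space)

lemma finite_window: "finite_measure (window T)"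
  by (intro finite_measureI) (simp add: window_def space_restrict_space emeasure_restrict_space emeasure_lborel_Icc_eq)

lemma measure_window: "0 \<le> T \<Longrightarrow> measure (window T) (space (window T)) = T"
  by (simp add: window_def space_restrict_space measure_restrict_space)

text \<open>
  Substituting \<open>r = y - x\<close> and exchanging the integrals, the weight of \<open>r\<close> is the length of the
  overlap of the window with its translate by \<open>r\<close>, which is \<open>T - \<bar>r\<bar>\<close> as long as this
  is positive. Because \<open>g\<close> is nonnegative, the calculation can be done with Lebesgue integrals in
  the extended reals, where both exchanges are free.
\<close>
lemma double_integral_of_difference:
  fixes g :: "real \<Rightarrow> real"
  assumes [measurable]: "g \<in> borel_measurable borel" and nonneg: "\<And>r. 0 \<le> g r" and "0 \<le> T"
  shows "(\<integral>p. g (snd p - fst p) \<partial>(window T \<Otimes>\<^sub>M window T)) = (\<integral>r. g r * max 0 (T - \<bar>r\<bar>) \<partial>lborel)"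
proof -
  define N where "N = window T"
  interpret N: finite_measure N
    unfolding N_def by (rule finite_window)
  have id[measurable]: "(\<lambda>x. x) \<in> N \<rightarrow>\<^sub>M borel"
    unfolding N_def window_def by (intro measurable_restrict_space1) simp
  have [measurable]: "fst \<in> N \<Otimes>\<^sub>M N \<rightarrow>\<^sub>M borel" "snd \<in> N \<Otimes>\<^sub>M N \<rightarrow>\<^sub>M borel"
    using measurable_compose[OF measurable_fst id] measurable_compose[OF measurable_snd id]
    by simp_all
  have meas: "(\<lambda>p. g (snd p - fst p)) \<in> borel_measurable (N \<Otimes>\<^sub>M N)" by measurable
  have overlap: "(\<integral>\<^sup>+x. indicator {0..T} (x + r) * indicator {0..T} x \<partial>lborel)
      = ennreal (max 0 (T - \<bar>r\<bar>))" for r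
  proof -
    have "(\<integral>\<^sup>+x. indicator {0..T} (x + r) * indicator {0..T} x \<partial>lborel)
        = (\<integral>\<^sup>+x. indicator {max 0 (- r)..min T (T - r)} x \<partial>lborel)"
      by (intro nn_integral_cong) (auto simp: indicator_def)
    also have "\<dots> = ennreal (max 0 (T - \<bar>r\<bar>))"
      using \<open>0 \<le> T\<close> by (auto simp: emeasure_lborel_Icc_eq max_def min_def)
    finally show ?thesis .
  qed
  have "(\<integral>\<^sup>+p. ennreal (g (snd p - fst p)) \<partial>(N \<Otimes>\<^sub>M N))
      = (\<integral>\<^sup>+x. (\<integral>\<^sup>+y. ennreal (g (y - x)) \<partial>N) \<partial>N)"
    using N.nn_integral_fst[of "\<lambda>p. ennreal (g (snd p - fst p))" N] meas by simp
  also have "\<dots> = (\<integral>\<^sup>+x. (\<integral>\<^sup>+y. ennreal (g (y - x)) * indicator {0..T} y \<partial>lborel)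
      * indicator {0..T} x \<partial>lborel)"
    unfolding N_def window_def by (simp add: nn_integral_restrict_space)
  also have "\<dots> = (\<integral>\<^sup>+x. (\<integral>\<^sup>+r. ennreal (g r) * indicator {0..T} (x + r) \<partial>lborel)
      * indicator {0..T} x \<partial>lborel)"
    by (intro nn_integral_cong arg_cong2[where f = "(*)"] refl
        nn_integral_real_affine[where c = 1, simplified, THEN trans]) simp_all
  also have "\<dots> = (\<integral>\<^sup>+x. (\<integral>\<^sup>+r. ennreal (g r) * indicator {0..T} (x + r) * indicator {0..T} x
      \<partial>lborel) \<partial>lborel)"
    by (simp add: nn_integral_multc)
  also have "\<dots> = (\<integral>\<^sup>+r. (\<integral>\<^sup>+x. ennreal (g r) * indicator {0..T} (x + r) * indicator {0..T} x
      \<partial>lborel) \<partial>lborel)"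
    by (intro lborel_pair.Fubini') measurable
  also have "\<dots> = (\<integral>\<^sup>+r. ennreal (g r) * ennreal (max 0 (T - \<bar>r\<bar>)) \<partial>lborel)"
    unfolding overlap[symmetric] mult.assoc by (intro nn_integral_cong nn_integral_cmult) measurable
  also have "\<dots> = (\<integral>\<^sup>+r. ennreal (g r * max 0 (T - \<bar>r\<bar>)) \<partial>lborel)"
    by (simp add: ennreal_mult nonneg)
  finally show ?thesis
    unfolding N_def[symmetric] using meas by (subst (1 2) integral_eq_nn_integral) (simp_all add: nonneg)
qed

lemma half_line_integral_of_even:
  fixes g :: "real \<Rightarrow> real"
  assumes g: "integrable lborel g" and even: "\<And>r. g (- r) = g r"
  shows "(\<integral>r. g r \<partial>lborel) = 2 * (LBINT r:{0..}. g r)"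
proof -
  have [measurable]: "g \<in> borel_measurable borel" using g by auto
  have i: "integrable lborel (\<lambda>r. indicator A r * g r)" if "A \<in> sets borel" for A
    using integrable_mult_indicator[OF _ g, of A] that by simp
  have "(\<integral>r. g r \<partial>lborel) = (\<integral>r. indicator {0..} r * g r + indicator {..<0} r * g r \<partial>lborel)"
    by (intro Bochner_Integration.integral_cong) (auto simp: indicator_def)
  also have "\<dots> = (\<integral>r. indicator {0..} r * g r \<partial>lborel) + (\<integral>r. indicator {..<0} r * g r \<partial>lborel)"
    using i by (intro Bochner_Integration.integral_add) simp_all
  also have "(\<integral>r. indicator {..<0} r * g r \<partial>lborel) = (\<integral>r. indicator {0<..} r * g r \<partial>lborel)"
    by (subst lborel_integral_real_affine[where c = "-1" and t = 0])
       (auto simp: even indicator_def intro!: Bochner_Integration.integral_cong)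
  also have "\<dots> = (\<integral>r. indicator {0..} r * g r \<partial>lborel)"
    using AE_lborel_singleton[of "0::real"]
    by (intro integral_cong_AE) (auto simp: indicator_def elim!: eventually_mono)
  finally show ?thesis by (simp add: set_lebesgue_integral_def)
qed

section \<open>Almost sure convergence from second moments\<close>

text \<open>
  By monotone convergence the series of the squares has finite expectation, so it converges almost
  surely, and its terms tend to zero.
\<close>
lemma AE_tendsto_0_of_summable_second_moments:
  fixes X :: "nat \<Rightarrow> 'a \<Rightarrow> real"
  assumes int: "\<And>n. integrable M (\<lambda>\<omega>. (X n \<omega>)\<^sup>2)"
    and sum: "summable (\<lambda>n. \<integral>\<omega>. (X n \<omega>)\<^sup>2 \<partial>M)"
  shows "AE \<omega> in M. (\<lambda>n. X n \<omega>) \<longlonglongrightarrow> 0"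
proof -
  have [measurable]: "(\<lambda>\<omega>. (X n \<omega>)\<^sup>2) \<in> borel_measurable M" for n
    using int by auto
  have "(\<integral>\<^sup>+\<omega>. (\<Sum>n. ennreal ((X n \<omega>)\<^sup>2)) \<partial>M) = (\<Sum>n. \<integral>\<^sup>+\<omega>. ennreal ((X n \<omega>)\<^sup>2) \<partial>M)"
    by (intro nn_integral_suminf) simp
  also have "\<dots> = (\<Sum>n. ennreal (\<integral>\<omega>. (X n \<omega>)\<^sup>2 \<partial>M))"
    using int by (simp add: nn_integral_eq_integral)
  also have "\<dots> = ennreal (\<Sum>n. \<integral>\<omega>. (X n \<omega>)\<^sup>2 \<partial>M)"
    using sum by (intro suminf_ennreal2) simp_all
  finally have "(\<integral>\<^sup>+\<omega>. (\<Sum>n. ennreal ((X n \<omega>)\<^sup>2)) \<partial>M) \<noteq> \<infinity>" by simp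
  moreover have "(\<lambda>\<omega>. \<Sum>n. ennreal ((X n \<omega>)\<^sup>2)) \<in> borel_measurable M"
    by measurable
  ultimately have "AE \<omega> in M. (\<Sum>n. ennreal ((X n \<omega>)\<^sup>2)) \<noteq> \<infinity>"
    by (intro nn_integral_PInf_AE)
  then show ?thesis
  proof eventually_elim
    case (elim \<omega>)
    then have "summable (\<lambda>n. (X n \<omega>)\<^sup>2)"
      by (intro summable_suminf_not_top) simp_all
    then have "(\<lambda>n. (X n \<omega>)\<^sup>2) \<longlonglongrightarrow> 0" by (rule summable_LIMSEQ_zero)
    then show ?case by simp
  qed
qed

text \<open>
  A monotone \<open>F\<close> cannot oscillate between consecutive squares: for \<open>n^2 \<le> T \<le> (n + 1)^2\<close> the
  average \<open>F T / T\<close> lies between \<open>F (n^2) / (n + 1)^2\<close> and \<open>F ((n + 1)^2) / n^2\<close>, and consecutive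
  squares have ratio tending to one. This is what upgrades convergence along a sparse sequence to
  convergence of the whole family.
\<close>
lemma tendsto_average_of_squares:
  fixes F :: "real \<Rightarrow> real"
  assumes mono: "mono_on {0<..} F" and nonneg: "\<And>T. 0 < T \<Longrightarrow> 0 \<le> F T"
    and lim: "(\<lambda>n. F ((real n)\<^sup>2) / (real n)\<^sup>2) \<longlonglongrightarrow> v"
  shows "((\<lambda>T. F T / T) \<longlongrightarrow> v) at_top"
proof -
  define a where "a n = F ((real n)\<^sup>2) / (real n)\<^sup>2" for n
  define k where "k T = nat \<lfloor>sqrt T\<rfloor>" for T
  have k: "filterlim k at_top at_top"
    unfolding k_def
    by (intro filterlim_compose[OF filterlim_nat_sequentially]
        filterlim_compose[OF filterlim_floor_sequentially] sqrt_at_top)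
  have ratio: "(\<lambda>n. (real n / real (Suc n))\<^sup>2) \<longlonglongrightarrow> 1" "(\<lambda>n. (real (Suc n) / real n)\<^sup>2) \<longlonglongrightarrow> 1"
    using tendsto_power[OF LIMSEQ_n_over_Suc_n, of 2] tendsto_power[OF LIMSEQ_Suc_n_over_n, of 2] by simp_all
  have lo: "(\<lambda>n. a n * (real n / real (Suc n))\<^sup>2) \<longlonglongrightarrow> v"
    using tendsto_mult[OF lim ratio(1)] by (simp add: a_def)
  have hi: "(\<lambda>n. a (Suc n) * (real (Suc n) / real n)\<^sup>2) \<longlonglongrightarrow> v"
    using tendsto_mult[OF LIMSEQ_Suc[OF lim] ratio(2)] by (simp add: a_def)
  have sandwich: "a (k T) * (real (k T) / real (Suc (k T)))\<^sup>2 \<le> F T / T \<and>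
      F T / T \<le> a (Suc (k T)) * (real (Suc (k T)) / real (k T))\<^sup>2" if "1 \<le> T" for T
  proof -
    let ?n = "real (k T)" and ?m = "real (Suc (k T))"
    have "1 \<le> sqrt T" using that by simp
    then have n: "1 \<le> ?n" "?n \<le> sqrt T" "sqrt T \<le> ?m"
      unfolding k_def by (simp_all add: le_nat_floor) linarith+
    have "?n\<^sup>2 \<le> (sqrt T)\<^sup>2" "(sqrt T)\<^sup>2 \<le> ?m\<^sup>2"
      by (rule power_mono[OF n(2)], simp, rule power_mono[OF n(3)]) (use that in simp)
    then have T: "?n\<^sup>2 \<le> T" "T \<le> ?m\<^sup>2" using that by simp_all
    have pos: "0 < ?n\<^sup>2" "0 < ?m\<^sup>2" using n(1) by simp_all
    have F: "F (?n\<^sup>2) \<le> F T" "F T \<le> F (?m\<^sup>2)" "0 \<le> F (?n\<^sup>2)" "0 \<le> F T"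
      using T pos that by (auto intro!: mono_onD[OF mono] nonneg)
    have "a (k T) * (?n / ?m)\<^sup>2 = F (?n\<^sup>2) / ?m\<^sup>2"
      using pos by (simp add: a_def power_divide del: of_nat_Suc)
    also have "\<dots> \<le> F T / T"
      using F T that by (intro frac_le) simp_all
    finally have 1: "a (k T) * (?n / ?m)\<^sup>2 \<le> F T / T" .
    have "F T / T \<le> F (?m\<^sup>2) / ?n\<^sup>2"
      using F T pos that by (intro frac_le) simp_all
    also have "\<dots> = a (Suc (k T)) * (?m / ?n)\<^sup>2"
      using pos by (simp add: a_def power_divide del: of_nat_Suc)
    finally show ?thesis using 1 by simp
  qed
  show ?thesis
  proof (rule tendsto_sandwich)
    show "((\<lambda>T. a (k T) * (real (k T) / real (Suc (k T)))\<^sup>2) \<longlongrightarrow> v) at_top"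
      by (rule filterlim_compose[OF lo k])
    show "((\<lambda>T. a (Suc (k T)) * (real (Suc (k T)) / real (k T))\<^sup>2) \<longlongrightarrow> v) at_top"
      by (rule filterlim_compose[OF hi k])
    show "\<forall>\<^sub>F T in at_top. a (k T) * (real (k T) / real (Suc (k T)))\<^sup>2 \<le> F T / T"
      by (rule eventually_mono[OF eventually_ge_at_top sandwich[THEN conjunct1]])
    show "\<forall>\<^sub>F T in at_top. F T / T \<le> a (Suc (k T)) * (real (Suc (k T)) / real (k T))\<^sup>2"
      by (rule eventually_mono[OF eventually_ge_at_top sandwich[THEN conjunct2]])
  qed
qed

section \<open>Second-order structure of a stationary Gaussian process\<close>

locale stationary_gaussian = prob_space M for M :: "'a measure" +
  fixes Z :: "real \<Rightarrow> 'a \<Rightarrow> real"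
  assumes gaussian: "gaussian_process M Z"
    and continuous: "continuous_process M Z"
    and centered: "centered_process M Z"
    and stationary: "stationary_process M Z"
    and rho_sq: "integrable lborel (\<lambda>r. (rho M Z r)\<^sup>2)"
begin

abbreviation v :: real where "v \<equiv> f_Z M Z"

lemma Z_integrable: "0 \<le> t \<Longrightarrow> integrable M (Z t)"
  and Z_mean: "0 \<le> t \<Longrightarrow> integral\<^sup>L M (Z t) = 0"
  using centered by (auto simp: centered_process_def)

lemma Z_measurable: "0 \<le> t \<Longrightarrow> Z t \<in> borel_measurable M"
  using Z_integrable by blast

lemma path_continuous: "\<omega> \<in> space M \<Longrightarrow> continuous_on {0..} (\<lambda>t. Z t \<omega>)"
  using continuous by (auto simp: continuous_process_def)

text \<open>
  Stationarity concerns laws of random vectors on \<open>{0, d}\<close>; integrating the product of the two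
  coordinates against these laws turns it into invariance of the covariance. If \<open>d = 0\<close> the index
  set is a singleton and the product is a square, without any change to the argument.
\<close>
lemma product_moment_shift:
  assumes "0 \<le> h" "0 \<le> d"
  shows "(\<integral>\<omega>. Z h \<omega> * Z (d + h) \<omega> \<partial>M) = (\<integral>\<omega>. Z 0 \<omega> * Z d \<omega> \<partial>M)"
proof -
  define J where "J = {0, d}"
  define \<phi> where "\<phi> x = x 0 * x d" for x :: "real \<Rightarrow> real"
  have J: "finite J" "J \<subseteq> {0..}" using assms by (auto simp: J_def)
  have \<phi>: "\<phi> \<in> borel_measurable (\<Pi>\<^sub>M t\<in>J. borel)"
    unfolding \<phi>_def by (intro borel_measurable_times measurable_component_singleton) (auto simp: J_def)
  have law: "(\<lambda>\<omega>. \<lambda>t\<in>J. Z (t + s) \<omega>) \<in> M \<rightarrow>\<^sub>M (\<Pi>\<^sub>M t\<in>J. borel)" if "0 \<le> s" for s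
    using J that by (intro measurable_restrict Z_measurable) auto
  have moment: "(\<integral>x. \<phi> x \<partial>distr M (\<Pi>\<^sub>M t\<in>J. borel) (\<lambda>\<omega>. \<lambda>t\<in>J. Z (t + s) \<omega>))
      = (\<integral>\<omega>. Z s \<omega> * Z (d + s) \<omega> \<partial>M)" if "0 \<le> s" for s
    unfolding integral_distr[OF law[OF that] \<phi>] by (simp add: \<phi>_def J_def)
  have "distr M (\<Pi>\<^sub>M t\<in>J. borel) (\<lambda>\<omega>. \<lambda>t\<in>J. Z (t + h) \<omega>)
      = distr M (\<Pi>\<^sub>M t\<in>J. borel) (\<lambda>\<omega>. \<lambda>t\<in>J. Z (t + 0) \<omega>)"
    using stationary J \<open>0 \<le> h\<close> by (simp add: stationary_process_def)
  then show ?thesis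
    using moment[of h] moment[of 0] \<open>0 \<le> h\<close> by simp
qed

lemma covariance:
  assumes "0 \<le> s" "0 \<le> t"
  shows "(\<integral>\<omega>. Z s \<omega> * Z t \<omega> \<partial>M) = rho M Z (t - s)"
proof (cases "s \<le> t")
  case True
  then show ?thesis
    using product_moment_shift[of s "t - s"] assms by (simp add: rho_def)
next
  case False
  then show ?thesis
    using product_moment_shift[of t "s - t"] assms by (simp add: rho_def mult.commute)
qed

lemma rho_even: "rho M Z (- r) = rho M Z r"
  by (simp add: rho_def)

lemma second_moment: "0 \<le> t \<Longrightarrow> (\<integral>\<omega>. (Z t \<omega>)\<^sup>2 \<partial>M) = v"
  using covariance[of t t] by (simp add: rho_def f_Z_def power2_eq_square)

text \<open>
  A Gaussian process is described through sums over finite sets of distinct times; coinciding times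
  are merged into one coefficient.
\<close>
lemma gaussian_combination:
  assumes "0 \<le> s" "0 \<le> t"
  shows "gaussian_rv M (\<lambda>\<omega>. a * Z s \<omega> + b * Z t \<omega>)"
proof (cases "s = t")
  case True
  have "gaussian_rv M (\<lambda>\<omega>. \<Sum>r\<in>{s}. (a + b) * Z r \<omega>)"
    using gaussian[unfolded gaussian_process_def, rule_format, of "{s}" "\<lambda>_. a + b"] assms by auto
  then show ?thesis using True by (simp add: distrib_right)
next
  case False
  have "gaussian_rv M (\<lambda>\<omega>. \<Sum>r\<in>{s, t}. (if r = s then a else b) * Z r \<omega>)"
    using gaussian[unfolded gaussian_process_def, rule_format, of "{s, t}" "\<lambda>r. if r = s then a else b"]
      assms by auto
  then show ?thesis using False by simp
qed

lemmas isserlis = isserlis_squares[OF prob_space_axioms gaussian_combination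
    Z_integrable Z_integrable Z_mean Z_mean]

lemma Z_sq_integrable: "0 \<le> t \<Longrightarrow> integrable M (\<lambda>\<omega>. (Z t \<omega>)\<^sup>2)"
  using isserlis(1)[of t t] by (simp add: power2_eq_square)

text \<open>
  Gaussianity expresses the fourth-order structure through \<open>\<rho>\<close>. That the autocovariance of the
  squared process is a multiple of \<open>\<rho>^2\<close> is why square integrability of \<open>\<rho>\<close> is the right
  condition for the estimator.
\<close>
lemma covariance_of_squares:
  assumes "0 \<le> s" "0 \<le> t"
  shows "integrable M (\<lambda>\<omega>. ((Z s \<omega>)\<^sup>2 - v) * ((Z t \<omega>)\<^sup>2 - v))"
    and "(\<integral>\<omega>. ((Z s \<omega>)\<^sup>2 - v) * ((Z t \<omega>)\<^sup>2 - v) \<partial>M) = 2 * (rho M Z (t - s))\<^sup>2"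
proof -
  have split: "((Z s \<omega>)\<^sup>2 - v) * ((Z t \<omega>)\<^sup>2 - v)
      = (Z s \<omega>)\<^sup>2 * (Z t \<omega>)\<^sup>2 - v * (Z s \<omega>)\<^sup>2 - v * (Z t \<omega>)\<^sup>2 + v * v" for \<omega>
    by algebra
  note int = isserlis(2)[OF assms assms assms] Z_sq_integrable[OF assms(1)] Z_sq_integrable[OF assms(2)]
  show "integrable M (\<lambda>\<omega>. ((Z s \<omega>)\<^sup>2 - v) * ((Z t \<omega>)\<^sup>2 - v))"
    unfolding split using int by simp
  show "(\<integral>\<omega>. ((Z s \<omega>)\<^sup>2 - v) * ((Z t \<omega>)\<^sup>2 - v) \<partial>M) = 2 * (rho M Z (t - s))\<^sup>2"
    unfolding split
    using int isserlis(3)[OF assms assms assms] second_moment assms covariance[OF assms]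
    by (simp add: prob_space)
qed

section \<open>Mean and mean square error of the estimator\<close>

lemma Z_sq_measurable_window:
  "(\<lambda>(t, \<omega>). (Z t \<omega>)\<^sup>2) \<in> borel_measurable (window T \<Otimes>\<^sub>M M)"
proof -
  have "(\<lambda>p. (fst p, snd p)) \<in> window T \<Otimes>\<^sub>M M \<rightarrow>\<^sub>M borel \<Otimes>\<^sub>M M"
    by (intro measurable_Pair measurable_snd measurable_compose[OF measurable_fst])
       (simp add: window_def measurable_restrict_space1)
  from measurable_compose[OF this measurable_of_continuous_paths[OF Z_measurable path_continuous]]
  have "(\<lambda>p. Z (max 0 (fst p)) (snd p)) \<in> borel_measurable (window T \<Otimes>\<^sub>M M)"
    by simp
  then have "(\<lambda>p. (Z (max 0 (fst p)) (snd p))\<^sup>2) \<in> borel_measurable (window T \<Otimes>\<^sub>M M)"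
    by (rule borel_measurable_power)
  then show ?thesis
    by (rule measurable_cong[THEN iffD1, rotated])
       (auto simp: space_pair_measure space_window max_def)
qed

lemma path_integrable:
  assumes "\<omega> \<in> space M"
  shows "integrable (window T) (\<lambda>t. (Z t \<omega>)\<^sup>2)"
proof -
  have "continuous_on {0..T} (\<lambda>t. (Z t \<omega>)\<^sup>2)"
    by (intro continuous_on_power continuous_on_subset[OF path_continuous[OF assms]]) auto
  from borel_integrable_atLeastAtMost'[OF this] show ?thesis
    by (simp add: window_def integrable_restrict_space set_integrable_def)
qed

lemma f_hat_window: "f_hat Z T \<omega> = (\<integral>t. (Z t \<omega>)\<^sup>2 \<partial>window T) / T"
  by (simp add: f_hat_def window_def integral_restrict_space set_lebesgue_integral_def)

lemma f_hat_unbiased: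
  assumes "0 < T"
  shows "integrable M (f_hat Z T)" and "(\<integral>\<omega>. f_hat Z T \<omega> \<partial>M) = v"
proof -
  have bound: "(\<integral>\<omega>. \<bar>(Z t \<omega>)\<^sup>2\<bar> \<partial>M) \<le> v" if "t \<in> space (window T)" for t
    using that second_moment[of t] by (simp add: space_window)
  have int: "integrable M (\<lambda>\<omega>. (Z t \<omega>)\<^sup>2)" if "t \<in> space (window T)" for t
    using that Z_sq_integrable[of t] by (simp add: space_window)
  note fub = expectation_of_integral[OF finite_window sigma_finite_measure_axioms
      Z_sq_measurable_window int bound]
  show "integrable M (f_hat Z T)"
    unfolding f_hat_window using fub(1) by simp
  have "(\<integral>\<omega>. (\<integral>t. (Z t \<omega>)\<^sup>2 \<partial>window T) \<partial>M) = (\<integral>t. (\<integral>\<omega>. (Z t \<omega>)\<^sup>2 \<partial>M) \<partial>window T)"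
    by (rule fub(2))
  also have "\<dots> = (\<integral>t. v \<partial>window T)"
    by (intro Bochner_Integration.integral_cong) (simp_all add: space_window second_moment)
  finally show "(\<integral>\<omega>. f_hat Z T \<omega> \<partial>M) = v"
    unfolding f_hat_window using \<open>0 < T\<close> by (simp add: measure_window)
qed

text \<open>
  The mean square error is a double integral of \<open>2 \<rho>^2\<close> over pairs of times, which depends on
  their difference only. Normalized by \<open>T\<close>, the weights \<open>T - \<bar>r\<bar>\<close> become the triangular
  taper \<open>1 - \<bar>r\<bar> / T\<close>, which increases to one with \<open>T\<close>: monotonicity, the limit and
  the rate \<open>1 / T\<close> of the variance are all read off this formula.
\<close>
lemma f_hat_mean_square_error:
  assumes "0 < T"
  shows "integrable M (\<lambda>\<omega>. (f_hat Z T \<omega> - v)\<^sup>2)"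
    and "T * (\<integral>\<omega>. (f_hat Z T \<omega> - v)\<^sup>2 \<partial>M)
      = 2 * (\<integral>r. (rho M Z r)\<^sup>2 * max 0 (1 - \<bar>r\<bar> / T) \<partial>lborel)"
proof -
  define Y where "Y t \<omega> = (Z t \<omega>)\<^sup>2 - v" for t \<omega>
  interpret N: finite_measure "window T" by (rule finite_window)
  have error: "f_hat Z T \<omega> - v = (\<integral>t. Y t \<omega> \<partial>window T) / T" if "\<omega> \<in> space M" for \<omega>
    unfolding f_hat_window Y_def using path_integrable[OF that, of T] measure_window[of T] \<open>0 < T\<close>
    by (simp add: diff_divide_distrib)
  have Y_meas: "case_prod Y \<in> borel_measurable (window T \<Otimes>\<^sub>M M)"
    using borel_measurable_diff[OF Z_sq_measurable_window[of T] borel_measurable_const[of v]]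
    by (simp add: Y_def case_prod_unfold)
  have Y_sq: "integrable M (\<lambda>\<omega>. (Y t \<omega>)\<^sup>2)" if "t \<in> space (window T)" for t
    using covariance_of_squares(1)[of t t] that by (simp add: Y_def power2_eq_square space_window)
  have Y_bound: "(\<integral>\<omega>. (Y t \<omega>)\<^sup>2 \<partial>M) \<le> 2 * (rho M Z 0)\<^sup>2" if "t \<in> space (window T)" for t
    using covariance_of_squares(2)[of t t] that by (simp add: Y_def power2_eq_square space_window)
  have Y_path: "integrable (window T) (\<lambda>t. Y t \<omega>)" if "\<omega> \<in> space M" for \<omega>
    using path_integrable[OF that, of T] by (simp add: Y_def)
  note fub = second_moment_of_integral[OF finite_window sigma_finite_measure_axioms
      Y_meas Y_sq Y_bound Y_path]
  have err_sq: "(f_hat Z T \<omega> - v)\<^sup>2 = (\<integral>t. Y t \<omega> \<partial>window T)\<^sup>2 / T\<^sup>2" if "\<omega> \<in> space M" for \<omega>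
    by (simp add: error[OF that] power_divide)
  show "integrable M (\<lambda>\<omega>. (f_hat Z T \<omega> - v)\<^sup>2)"
    using fub(1) by (subst Bochner_Integration.integrable_cong[OF refl err_sq]) simp_all
  have [measurable]: "(\<lambda>r. (rho M Z r)\<^sup>2) \<in> borel_measurable borel"
    using rho_sq by auto
  have "(\<integral>\<omega>. (\<integral>t. Y t \<omega> \<partial>window T)\<^sup>2 \<partial>M)
      = (\<integral>p. (\<integral>\<omega>. Y (fst p) \<omega> * Y (snd p) \<omega> \<partial>M) \<partial>(window T \<Otimes>\<^sub>M window T))"
    by (rule fub(2))
  also have "\<dots> = (\<integral>p. 2 * (rho M Z (snd p - fst p))\<^sup>2 \<partial>(window T \<Otimes>\<^sub>M window T))"
    by (intro Bochner_Integration.integral_cong refl)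
       (auto simp: Y_def covariance_of_squares space_pair_measure space_window)
  also have "\<dots> = 2 * (\<integral>r. (rho M Z r)\<^sup>2 * max 0 (T - \<bar>r\<bar>) \<partial>lborel)"
    using double_integral_of_difference[of "\<lambda>r. (rho M Z r)\<^sup>2" T] \<open>0 < T\<close> by simp
  also have "\<dots> = 2 * (\<integral>r. T * ((rho M Z r)\<^sup>2 * max 0 (1 - \<bar>r\<bar> / T)) \<partial>lborel)"
  proof -
    have "max 0 (T - \<bar>r\<bar>) = T * max 0 (1 - \<bar>r\<bar> / T)" for r
      using \<open>0 < T\<close> by (simp add: max_def field_simps)
    then show ?thesis by (simp add: mult.left_commute)
  qed
  finally have E: "(\<integral>\<omega>. (\<integral>t. Y t \<omega> \<partial>window T)\<^sup>2 \<partial>M)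
      = 2 * T * (\<integral>r. (rho M Z r)\<^sup>2 * max 0 (1 - \<bar>r\<bar> / T) \<partial>lborel)" by simp
  have "(\<integral>\<omega>. (f_hat Z T \<omega> - v)\<^sup>2 \<partial>M) = (\<integral>\<omega>. (\<integral>t. Y t \<omega> \<partial>window T)\<^sup>2 / T\<^sup>2 \<partial>M)"
    by (intro Bochner_Integration.integral_cong refl err_sq)
  also have "\<dots> = 2 * T * (\<integral>r. (rho M Z r)\<^sup>2 * max 0 (1 - \<bar>r\<bar> / T) \<partial>lborel) / T\<^sup>2"
    by (simp add: E)
  finally show "T * (\<integral>\<omega>. (f_hat Z T \<omega> - v)\<^sup>2 \<partial>M)
      = 2 * (\<integral>r. (rho M Z r)\<^sup>2 * max 0 (1 - \<bar>r\<bar> / T) \<partial>lborel)"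
    using \<open>0 < T\<close> by (simp add: power2_eq_square)
qed

section \<open>Monotonicity and limit of the normalized error\<close>

text \<open>
  Half of \<open>T\<close> times the mean square error.
\<close>
definition tapered :: "real \<Rightarrow> real" where
  "tapered T = (\<integral>r. (rho M Z r)\<^sup>2 * max 0 (1 - \<bar>r\<bar> / T) \<partial>lborel)"

lemma taper_le_1: "0 < T \<Longrightarrow> max 0 (1 - \<bar>r\<bar> / T) \<le> (1::real)"
  by simp

lemma tapered_integrable:
  assumes "0 < T"
  shows "integrable lborel (\<lambda>r. (rho M Z r)\<^sup>2 * max 0 (1 - \<bar>r\<bar> / T))"
proof (rule Bochner_Integration.integrable_bound[OF rho_sq])
  have [measurable]: "(\<lambda>r. (rho M Z r)\<^sup>2) \<in> borel_measurable lborel"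
    using rho_sq by auto
  show "(\<lambda>r. (rho M Z r)\<^sup>2 * max 0 (1 - \<bar>r\<bar> / T)) \<in> borel_measurable lborel" by measurable
  show "AE r in lborel. norm ((rho M Z r)\<^sup>2 * max 0 (1 - \<bar>r\<bar> / T)) \<le> norm ((rho M Z r)\<^sup>2)"
    using taper_le_1[OF assms] by (intro AE_I2) (simp add: abs_mult mult_left_le)
qed

lemma tapered_mono: "mono_on {0<..} tapered"
proof (rule mono_onI)
  fix S T :: real assume ST: "S \<in> {0<..}" "T \<in> {0<..}" "S \<le> T"
  have "max 0 (1 - \<bar>r\<bar> / S) \<le> max 0 (1 - \<bar>r\<bar> / T)" for r :: real
  proof -
    have "\<bar>r\<bar> / T \<le> \<bar>r\<bar> / S" using ST by (intro divide_left_mono) simp_all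
    then show ?thesis by linarith
  qed
  then show "tapered S \<le> tapered T"
    unfolding tapered_def using ST
    by (intro integral_mono tapered_integrable mult_left_mono) simp_all
qed

lemma tapered_tendsto: "(tapered \<longlongrightarrow> (\<integral>r. (rho M Z r)\<^sup>2 \<partial>lborel)) at_top"
  unfolding tapered_def
proof (rule integral_dominated_convergence_at_top)
  have [measurable]: "(\<lambda>r. (rho M Z r)\<^sup>2) \<in> borel_measurable lborel"
    using rho_sq by auto
  show "(\<lambda>r. (rho M Z r)\<^sup>2) \<in> borel_measurable lborel" by measurable
  show "(\<lambda>r. (rho M Z r)\<^sup>2 * max 0 (1 - \<bar>r\<bar> / T)) \<in> borel_measurable lborel" for T
    by measurable
  show "integrable lborel (\<lambda>r. (rho M Z r)\<^sup>2)" by (rule rho_sq)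
  show "\<forall>\<^sub>F T in at_top. AE r in lborel.
      norm ((rho M Z r)\<^sup>2 * max 0 (1 - \<bar>r\<bar> / T)) \<le> (rho M Z r)\<^sup>2"
    using eventually_gt_at_top[of 0]
  proof eventually_elim
    case (elim T)
    show ?case using taper_le_1[OF elim] by (intro AE_I2) (simp add: abs_mult mult_left_le)
  qed
  have "((\<lambda>T. (rho M Z r)\<^sup>2 * max 0 (1 - \<bar>r\<bar> / T)) \<longlongrightarrow> (rho M Z r)\<^sup>2 * max 0 (1 - 0)) at_top" for r
    by (intro tendsto_intros tendsto_max real_tendsto_divide_at_top[OF tendsto_const] filterlim_ident)
  then show "AE r in lborel.
      ((\<lambda>T. (rho M Z r)\<^sup>2 * max 0 (1 - \<bar>r\<bar> / T)) \<longlongrightarrow> (rho M Z r)\<^sup>2) at_top"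
    by simp
qed

lemma scaled_L2_error:
  assumes "0 < T"
  shows "sqrt T * L2_norm M (\<lambda>\<omega>. f_hat Z T \<omega> - v) = sqrt (2 * tapered T)"
  using f_hat_mean_square_error(2)[OF assms]
  by (simp add: L2_norm_def tapered_def flip: real_sqrt_mult)

lemma sigma_Z_eq: "sigma_Z M Z = sqrt (2 * (\<integral>r. (rho M Z r)\<^sup>2 \<partial>lborel))"
  using half_line_integral_of_even[OF rho_sq] by (simp add: sigma_Z_def rho_even)

section \<open>Strong consistency\<close>

lemma f_hat_error_bound:
  assumes "0 < T"
  shows "(\<integral>\<omega>. (f_hat Z T \<omega> - v)\<^sup>2 \<partial>M) \<le> 2 * (\<integral>r. (rho M Z r)\<^sup>2 \<partial>lborel) / T"
proof -
  have "tapered T \<le> (\<integral>r. (rho M Z r)\<^sup>2 \<partial>lborel)"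
    unfolding tapered_def using taper_le_1[OF assms]
    by (intro integral_mono tapered_integrable[OF assms] rho_sq) (simp add: mult_left_le)
  then show ?thesis
    using f_hat_mean_square_error(2)[OF assms] assms
    by (simp add: tapered_def field_simps)
qed

text \<open>
  The variance bound of order \<open>1 / T\<close> is summable along \<open>T = n^2\<close> but not along the integers, so
  almost sure convergence is obtained along the squares. It extends to all \<open>T\<close> because
  \<open>T * f_hat Z T\<close> integrates a nonnegative function and hence increases.
\<close>
lemma f_hat_strongly_consistent: "AE \<omega> in M. ((\<lambda>T. f_hat Z T \<omega>) \<longlongrightarrow> v) at_top"
proof -
  \<comment> \<open>Starting at \<open>1\<close> keeps the observation time positive.\<close>
  define X where "X n \<omega> = f_hat Z ((real (Suc n))\<^sup>2) \<omega> - v" for n \<omega>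
  have X_int: "integrable M (\<lambda>\<omega>. (X n \<omega>)\<^sup>2)" for n
    unfolding X_def by (rule f_hat_mean_square_error(1)) simp
  have "summable (\<lambda>n. \<integral>\<omega>. (X n \<omega>)\<^sup>2 \<partial>M)"
  proof (rule summable_comparison_test)
    let ?C = "2 * (\<integral>r. (rho M Z r)\<^sup>2 \<partial>lborel)"
    have "summable (\<lambda>n. ?C * inverse ((real (Suc n))\<^sup>2))"
      by (intro summable_mult
          summable_Suc_iff[THEN iffD2, of "\<lambda>n. inverse ((real n)\<^sup>2)"] inverse_power_summable) simp
    then show "summable (\<lambda>n. ?C / (real (Suc n))\<^sup>2)"
      by (simp only: divide_inverse)
    show "\<exists>N. \<forall>n\<ge>N. norm (\<integral>\<omega>. (X n \<omega>)\<^sup>2 \<partial>M) \<le> ?C / (real (Suc n))\<^sup>2"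
    proof (intro exI[of _ 0] allI impI)
      fix n
      have "(\<integral>\<omega>. (X n \<omega>)\<^sup>2 \<partial>M) \<le> ?C / (real (Suc n))\<^sup>2"
        unfolding X_def by (rule f_hat_error_bound) simp
      then show "norm (\<integral>\<omega>. (X n \<omega>)\<^sup>2 \<partial>M) \<le> ?C / (real (Suc n))\<^sup>2"
        by (simp del: of_nat_Suc)
    qed
  qed
  then have "AE \<omega> in M. (\<lambda>n. X n \<omega>) \<longlonglongrightarrow> 0"
    by (rule AE_tendsto_0_of_summable_second_moments[OF X_int])
  then show ?thesis
  proof (rule AE_mp, intro AE_I2 impI)
    fix \<omega> assume \<omega>: "\<omega> \<in> space M" and "(\<lambda>n. X n \<omega>) \<longlonglongrightarrow> 0"
    define F where "F T = (\<integral>t. (Z t \<omega>)\<^sup>2 \<partial>window T)" for T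
    have f_hat: "f_hat Z T \<omega> = F T / T" for T
      by (simp add: f_hat_window F_def)
    have "(\<lambda>n. f_hat Z ((real (Suc n))\<^sup>2) \<omega>) \<longlonglongrightarrow> v"
      using \<open>(\<lambda>n. X n \<omega>) \<longlonglongrightarrow> 0\<close> unfolding X_def by (rule LIM_zero_cancel)
    then have "(\<lambda>n. F ((real n)\<^sup>2) / (real n)\<^sup>2) \<longlonglongrightarrow> v"
      unfolding f_hat by (rule LIMSEQ_imp_Suc)
    moreover have "mono_on {0<..} F"
    proof (rule mono_onI)
      fix S T :: real assume "S \<le> T"
      have F_eq: "F R = (\<integral>t. indicator {0..R} t *\<^sub>R (Z t \<omega>)\<^sup>2 \<partial>lborel)"
        and int: "integrable lborel (\<lambda>t. indicator {0..R} t *\<^sub>R (Z t \<omega>)\<^sup>2)" for R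
        using path_integrable[OF \<omega>, of R] unfolding F_def window_def
        by (simp_all only: integral_restrict_space integrable_restrict_space
            space_lborel space_borel Int_UNIV_right sets_lborel borel_closed closed_atLeastAtMost)
      show "F S \<le> F T"
        unfolding F_eq using int \<open>S \<le> T\<close> by (intro integral_mono) (auto simp: indicator_def)
    qed
    moreover have "0 \<le> F T" for T
      unfolding F_def by simp
    ultimately show "((\<lambda>T. f_hat Z T \<omega>) \<longlongrightarrow> v) at_top"
      unfolding f_hat by (intro tendsto_average_of_squares)
  qed
qed

end

section \<open>The estimator is unbiased, strongly consistent, with increasing normalized error\<close>

theorem lemma3p1:
  fixes M :: "'a measure" and Z :: "real \<Rightarrow> 'a \<Rightarrow> real"
  assumes "prob_space M"
    and "gaussian_process M Z"
    and "continuous_process M Z"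
    and "centered_process M Z"
    and "stationary_process M Z"
    and "f_Z M Z > 0"
    and "integrable lborel (\<lambda>r. (rho M Z r)\<^sup>2)"
  shows "(\<forall>T>0. integrable M (f_hat Z T) \<and> (\<integral>\<omega>. f_hat Z T \<omega> \<partial>M) = f_Z M Z)
    \<and> (AE \<omega> in M. ((\<lambda>T. f_hat Z T \<omega>) \<longlongrightarrow> f_Z M Z) at_top)
    \<and> (\<forall>T>0. integrable M (\<lambda>\<omega>. (f_hat Z T \<omega> - f_Z M Z)\<^sup>2))
    \<and> mono_on {0<..} (\<lambda>T. sqrt T * L2_norm M (\<lambda>\<omega>. f_hat Z T \<omega> - f_Z M Z))
    \<and> ((\<lambda>T. sqrt T * L2_norm M (\<lambda>\<omega>. f_hat Z T \<omega> - f_Z M Z)) \<longlongrightarrow> sigma_Z M Z) at_top"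
proof -
  interpret stationary_gaussian M Z
    using assms by (simp add: stationary_gaussian_def stationary_gaussian_axioms_def)
  have mono: "mono_on {0<..} (\<lambda>T. sqrt T * L2_norm M (\<lambda>\<omega>. f_hat Z T \<omega> - f_Z M Z))"
    using mono_onD[OF tapered_mono] by (intro mono_onI) (simp add: scaled_L2_error)
  have "((\<lambda>T. sqrt (2 * tapered T)) \<longlongrightarrow> sigma_Z M Z) at_top"
    unfolding sigma_Z_eq by (intro tendsto_intros tapered_tendsto)
  then have lim: "((\<lambda>T. sqrt T * L2_norm M (\<lambda>\<omega>. f_hat Z T \<omega> - f_Z M Z)) \<longlongrightarrow> sigma_Z M Z) at_top"
    by (rule Lim_transform_eventually)
       (auto intro!: eventually_mono[OF eventually_gt_at_top[of 0]] simp: scaled_L2_error)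
  show ?thesis
    by (intro conjI allI impI f_hat_unbiased f_hat_strongly_consistent
        f_hat_mean_square_error(1) mono lim)
qed

end
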